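(* Let $n\geqslant 1$ be an integer and let $\mathcal S=(S_k)_{k\geqslant 1}$ be a nested sequence of finite subsets of $[-1,1]$ (i.e. $S_k\subset S_{k+1}$ for all $k\geqslant 1$) with $|S_k|=n^k$ for all $k\geqslant 1$. Then for all integers $d\geqslant 1$ and $\mu\geqslant 0$, the number $\mathrm N_d(\mu)=|\Gamma_d(\mu)|$ of nodes of the Smolyak grid $\Gamma_d(\mu)$ attached to $\mathcal S$ is $$\mathrm N_d(\mu)=n^d\sum_{k=0}^{\min\{d-1,\mu\}}\binom{d-1}{k}(-1)^k\binom{d+\mu-k-1}{\mu-k}n^{\mu-k}$$ and, equivalently, $$\mathrm N_d(\mu)=\sum_{k=0}^{\min\{d-1,\mu\}}\binom{d-1}{k}\binom{\mu}{k}n^{\mu+d-k}(n-1)^k$$ (with the convention $0^0=1$). In particular, for the Smolyak grid based on Chebyshev nodes of the first kind, $S_k=\mathrm C_1(3^k)$, one has $$\mathrm N_d(\mu)=\sum_{k=0}^{\min\{d-1,\mu\}}\binom{d-1}{k}\binom{\mu}{k}3^{\mu+d-k}2^k,$$ and for $S_k=\mathrm C_1(3^{k-1})$ one has the same formula divided by $3^d$, i.e. $\mathrm N_d(\mu)=\sum_{k=0}^{\min\{d-1,\mu\}}\binom{d-1}{k}\binom{\mu}{k}3^{\mu-k}2^k$.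
   Context: For a multi-index $\mathbf i=(i_1,\dots,i_d)\in\mathbb N_{\geqslant 1}^d$ (all entries positive integers), $|\mathbf i|=i_1+\dots+i_d$. The Smolyak grid in $d$ dimensions of level $\mu\in\mathbb N=\{0,1,2,\dots\}$ attached to a sequence $\mathcal S=(S_k)_{k\geqslant1}$ of finite subsets of $[-1,1]$ is $$\Gamma_d(\mu)=\bigcup_{\max\{d,\mu+1\}\leqslant|\mathbf i|\leqslant d+\mu}S_{i_1}\times\cdots\times S_{i_d}\subset[-1,1]^d,$$ the union being over $\mathbf i\in\mathbb N_{\geqslant1}^d$. If $\mathcal S$ is nested, this equals $\bigcup_{|\mathbf i|=d+\mu}S_{i_1}\times\cdots\times S_{i_d}$. Chebyshev nodes of the first kind: for $m\in\mathbb N_{\geqslant 1}$, $$\mathrm C_1(m)=\left\{\cos\left(\tfrac{2k-1}{2m}\pi\right)\ \middle|\ k\in\{1,\dots,m\}\right\}.$$ The sequences $S_k=\mathrm C_1(3^k)$ and $S_k=\mathrm C_1(3^{k-1})$ are nested. *)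

theory Defs
  imports Complex_Main "HOL-Library.FuncSet"
begin

(* Multi-indices and points of R^d are functions on {1..d}, extended by undefined outside {1..d}
   (PiE), so that distinct functions are distinct tuples.  This allows d to be an ordinary
   natural-number variable. *)

definition multi_indices :: "nat \<Rightarrow> (nat \<Rightarrow> nat) set" where
  "multi_indices d = ({1..d} \<rightarrow>\<^sub>E {1..})"

definition index_sum :: "nat \<Rightarrow> (nat \<Rightarrow> nat) \<Rightarrow> nat" where
  "index_sum d i = (\<Sum>j=1..d. i j)"

(* A sequence (S_k) with k >= 1 is a function on nat whose value at 0 is never used. *)

definition nested :: "(nat \<Rightarrow> real set) \<Rightarrow> bool" where
  "nested S \<longleftrightarrow> (\<forall>k\<ge>1. S k \<subseteq> S (k + 1))"

definition smolyak_grid :: "(nat \<Rightarrow> real set) \<Rightarrow> nat \<Rightarrow> nat \<Rightarrow> (nat \<Rightarrow> real) set" where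
  "smolyak_grid S d \<mu> =
     (\<Union>i \<in> {i \<in> multi_indices d. max d (\<mu> + 1) \<le> index_sum d i \<and> index_sum d i \<le> d + \<mu>}.
        \<Pi>\<^sub>E j \<in> {1..d}. S (i j))"

definition smolyak_count :: "(nat \<Rightarrow> real set) \<Rightarrow> nat \<Rightarrow> nat \<Rightarrow> nat" where
  "smolyak_count S d \<mu> = card (smolyak_grid S d \<mu>)"

definition cheb1 :: "nat \<Rightarrow> real set" where
  "cheb1 m = {cos ((2 * real k - 1) / (2 * real m) * pi) | k. k \<in> {1..m}}"

end

(* Nestedness gives every node y a level, the number k such that y first occurs in S_(k+1), and the
   grid is the set of tuples whose levels sum to at most \<mu>.  If |S_(k+1)| = c n^k, the numbers of
   nodes of exact level k have generating function F = c (1 - X) P with P = 1 / (1 - n X), so the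
   cumulative counts have generating function F^d / (1 - X) = c^d (1 - X)^(d-1) P^d.  The two
   formulas come from expanding (1 - X)^(d-1) P^d directly, and from (1 - X) P = 1 + (n - 1) X P. *)

theory Submission
  imports Defs "HOL-Computational_Algebra.Formal_Power_Series"
begin

section \<open>Levels of nodes and the recursion on the dimension\<close>

locale nested_finite_sets =
  fixes S :: "nat \<Rightarrow> real set"
  assumes nested: "nested S" and finite_S: "k \<ge> 1 \<Longrightarrow> finite (S k)"
begin

lemma mono: "j \<le> k \<Longrightarrow> S (Suc j) \<subseteq> S (Suc k)"
  by (rule lift_Suc_mono_le[of "\<lambda>k. S (Suc k)"]) (use nested in \<open>auto simp: nested_def\<close>)

definition nodes :: "real set" where
  "nodes = (\<Union>k. S (Suc k))"

definition level :: "real \<Rightarrow> nat" where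
  "level y = (LEAST k. y \<in> S (Suc k))"

text \<open>A node occurs at its own level and, by nestedness, in every later set. Membership in
  \<open>nodes\<close> is part of the equivalence because \<open>LEAST\<close> says nothing about
  points that never occur.\<close>

lemma in_S_iff_level: "y \<in> S (Suc k) \<longleftrightarrow> y \<in> nodes \<and> level y \<le> k"
proof
  assume "y \<in> nodes \<and> level y \<le> k"
  moreover from this have "y \<in> S (Suc (level y))"
    unfolding nodes_def level_def by (auto intro: LeastI)
  ultimately show "y \<in> S (Suc k)" using mono by blast
qed (auto simp: nodes_def level_def intro: Least_le)

definition bounded_level_tuples :: "nat \<Rightarrow> nat \<Rightarrow> (nat \<Rightarrow> real) set" where
  "bounded_level_tuples d \<mu> = {x \<in> {1..d} \<rightarrow>\<^sub>E nodes. (\<Sum>j=1..d. level (x j)) \<le> \<mu>}"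

text \<open>A factor S (i j) admits exactly the nodes with level + 1 at most i j, so summing over
  the d coordinates turns the bound d + \<mu> into \<mu>. For d = 0 the two sides differ: the lower
  bound \<mu> + 1 empties the grid, while \<open>bounded_level_tuples\<close> keeps the empty tuple,
  from which the recursion on d starts.\<close>

lemma smolyak_grid_eq:
  assumes "d \<ge> 1"
  shows "smolyak_grid S d \<mu> = bounded_level_tuples d \<mu>"
proof (intro equalityI subsetI)
  fix x assume "x \<in> smolyak_grid S d \<mu>"
  then obtain i where i: "i \<in> multi_indices d" "index_sum d i \<le> d + \<mu>"
    and x: "x \<in> (\<Pi>\<^sub>E j \<in> {1..d}. S (i j))"
    by (auto simp: smolyak_grid_def)
  have *: "x j \<in> nodes \<and> Suc (level (x j)) \<le> i j" if "j \<in> {1..d}" for j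
  proof -
    have "i j \<ge> 1" using i that by (auto simp: multi_indices_def PiE_iff)
    then obtain k where "i j = Suc k" by (cases "i j") auto
    moreover have "x j \<in> S (i j)" using x that by blast
    ultimately show ?thesis by (simp add: in_S_iff_level)
  qed
  have "(\<Sum>j=1..d. Suc (level (x j))) \<le> index_sum d i"
    unfolding index_sum_def by (rule sum_mono) (use * in blast)
  then have "(\<Sum>j=1..d. level (x j)) \<le> \<mu>"
    using i(2) by (simp add: sum.distrib sum_Suc)
  then show "x \<in> bounded_level_tuples d \<mu>"
    using x * by (auto simp: bounded_level_tuples_def PiE_iff)
next
  fix x assume "x \<in> bounded_level_tuples d \<mu>"
  then have x: "x \<in> {1..d} \<rightarrow>\<^sub>E nodes" and le: "(\<Sum>j=1..d. level (x j)) \<le> \<mu>"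
    by (auto simp: bounded_level_tuples_def)
  define r where "r = \<mu> - (\<Sum>j=1..d. level (x j))"
  \<comment> \<open>The least admissible index is level + 1 in each coordinate. The whole slack r
    goes to coordinate 1, which exists as d \<ge> 1, so that the index sum is exactly d + \<mu> and
    the lower bound in the grid holds as well.\<close>
  define i where "i = restrict (\<lambda>j. Suc (level (x j)) + (if j = 1 then r else 0)) {1..d}"
  have "index_sum d i = (\<Sum>j=1..d. Suc (level (x j)) + (if j = 1 then r else 0))"
    unfolding index_sum_def i_def by simp
  also have "\<dots> = d + (\<Sum>j=1..d. level (x j)) + r"
    using assms by (simp add: sum.distrib sum_Suc)
  also have "\<dots> = d + \<mu>" using le by (simp add: r_def)
  finally have sum: "index_sum d i = d + \<mu>" .
  have i: "i \<in> multi_indices d" by (auto simp: multi_indices_def i_def)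
  have "x j \<in> S (i j)" if "j \<in> {1..d}" for j
    using x that by (auto simp: i_def in_S_iff_level PiE_iff)
  then have "x \<in> (\<Pi>\<^sub>E j \<in> {1..d}. S (i j))" using x by (auto simp: PiE_iff)
  then show "x \<in> smolyak_grid S d \<mu>"
    using i sum assms by (auto simp: smolyak_grid_def intro!: bexI[of _ i])
qed

lemma bounded_level_tuples_0: "bounded_level_tuples 0 \<mu> = {\<lambda>_. undefined}"
  by (auto simp: bounded_level_tuples_def)

lemma finite_bounded_level_tuples: "finite (bounded_level_tuples d \<mu>)"
proof (rule finite_subset)
  show "bounded_level_tuples d \<mu> \<subseteq> {1..d} \<rightarrow>\<^sub>E S (Suc \<mu>)"
  proof
    fix x assume "x \<in> bounded_level_tuples d \<mu>"
    then have x: "x \<in> {1..d} \<rightarrow>\<^sub>E nodes" and le: "(\<Sum>j=1..d. level (x j)) \<le> \<mu>"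
      by (auto simp: bounded_level_tuples_def)
    have "level (x j) \<le> \<mu>" if "j \<in> {1..d}" for j
      using member_le_sum[of j "{1..d}" "\<lambda>j. level (x j)"] that le by simp
    then show "x \<in> {1..d} \<rightarrow>\<^sub>E S (Suc \<mu>)"
      using x by (auto simp: in_S_iff_level PiE_iff)
  qed
  show "finite ({1..d} \<rightarrow>\<^sub>E S (Suc \<mu>))"
    by (rule finite_PiE) (auto intro: finite_S)
qed

text \<open>Splitting off the last coordinate y leaves the budget \<mu> - level y for the others.
  Restricting y to S (Suc \<mu>) means level y \<le> \<mu>, so this subtraction is not truncated;
  the inverse resets coordinate d + 1 to \<open>undefined\<close> to stay extensional.\<close>

lemma bij_betw_bounded_level_tuples_Suc:
  "bij_betw (\<lambda>(y, x). x(Suc d := y))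
     (SIGMA y:S (Suc \<mu>). bounded_level_tuples d (\<mu> - level y)) (bounded_level_tuples (Suc d) \<mu>)"
proof (rule bij_betw_byWitness[where f' = "\<lambda>x. (x (Suc d), x(Suc d := undefined))"])
  show "\<forall>p\<in>SIGMA y:S (Suc \<mu>). bounded_level_tuples d (\<mu> - level y).
      (\<lambda>x. (x (Suc d), x(Suc d := undefined))) ((\<lambda>(y, x). x(Suc d := y)) p) = p"
    by (auto simp: bounded_level_tuples_def PiE_iff extensional_def fun_eq_iff)
  show "\<forall>x\<in>bounded_level_tuples (Suc d) \<mu>.
      (\<lambda>(y, x). x(Suc d := y)) (x (Suc d), x(Suc d := undefined)) = x"
    by simp
  have sum: "(\<Sum>j=1..d. level ((x(Suc d := y)) j)) = (\<Sum>j=1..d. level (x j))" for x y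
    by (rule sum.cong) auto
  show "(\<lambda>(y, x). x(Suc d := y)) ` (SIGMA y:S (Suc \<mu>). bounded_level_tuples d (\<mu> - level y))
      \<subseteq> bounded_level_tuples (Suc d) \<mu>"
    by (auto simp: bounded_level_tuples_def PiE_iff extensional_def in_S_iff_level sum
        simp del: fun_upd_apply) (auto simp: le_Suc_eq)
  show "(\<lambda>x. (x (Suc d), x(Suc d := undefined))) ` bounded_level_tuples (Suc d) \<mu>
      \<subseteq> (SIGMA y:S (Suc \<mu>). bounded_level_tuples d (\<mu> - level y))"
    by (auto simp: bounded_level_tuples_def PiE_iff extensional_def in_S_iff_level sum
        simp del: fun_upd_apply) auto
qed

text \<open>Grouping the last coordinate by its level gives a convolution, that is, a product of
  generating functions.\<close>

lemma card_bounded_level_tuples_Suc: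
  "card (bounded_level_tuples (Suc d) \<mu>) =
     (\<Sum>k\<le>\<mu>. card {y \<in> nodes. level y = k} * card (bounded_level_tuples d (\<mu> - k)))"
proof -
  have fin: "finite (S (Suc \<mu>))" by (simp add: finite_S)
  have "card (bounded_level_tuples (Suc d) \<mu>) =
      (\<Sum>y\<in>S (Suc \<mu>). card (bounded_level_tuples d (\<mu> - level y)))"
    using bij_betw_same_card[OF bij_betw_bounded_level_tuples_Suc[of d \<mu>]] fin
    by (simp add: card_SigmaI finite_bounded_level_tuples)
  also have "\<dots> = (\<Sum>k\<le>\<mu>. \<Sum>y\<in>{y \<in> S (Suc \<mu>). level y = k}.
      card (bounded_level_tuples d (\<mu> - level y)))"
    by (rule sum.group[symmetric]) (auto simp: fin in_S_iff_level)
  also have "\<dots> = (\<Sum>k\<le>\<mu>. card {y \<in> nodes. level y = k} * card (bounded_level_tuples d (\<mu> - k)))"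
  proof (rule sum.cong[OF refl])
    fix k assume "k \<in> {..\<mu>}"
    then have "{y \<in> S (Suc \<mu>). level y = k} = {y \<in> nodes. level y = k}"
      by (auto simp: in_S_iff_level)
    then show "(\<Sum>y\<in>{y \<in> S (Suc \<mu>). level y = k}. card (bounded_level_tuples d (\<mu> - level y))) =
        card {y \<in> nodes. level y = k} * card (bounded_level_tuples d (\<mu> - k))"
      by simp
  qed
  finally show ?thesis .
qed

lemma card_level_0: "card {y \<in> nodes. level y = 0} = card (S 1)"
  by (rule arg_cong[of _ _ card]) (use in_S_iff_level[of _ 0] in auto)

lemma card_level_Suc:
  "int (card {y \<in> nodes. level y = Suc k}) = int (card (S (Suc (Suc k)))) - int (card (S (Suc k)))"
proof -
  have "{y \<in> nodes. level y = Suc k} = S (Suc (Suc k)) - S (Suc k)"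
    by (auto simp: in_S_iff_level)
  then have "card {y \<in> nodes. level y = Suc k} = card (S (Suc (Suc k))) - card (S (Suc k))"
    by (simp add: card_Diff_subset finite_S mono)
  moreover have "card (S (Suc k)) \<le> card (S (Suc (Suc k)))"
    by (intro card_mono finite_S mono) auto
  ultimately show ?thesis by simp
qed

end

section \<open>Coefficients of the power series (1 - X)^d P^(d+1)\<close>

unbundle fps_syntax

text \<open>This is P = 1 / (1 - n X), given by its coefficients so that it lives over the
  integers.\<close>

definition geometric_fps :: "int \<Rightarrow> int fps" where
  "geometric_fps n = Abs_fps (\<lambda>k. n ^ k)"

text \<open>In positive degree this is n^(k+1) - n^k = (n - 1) n^k.\<close>

lemma one_minus_X_times_geometric_fps:
  "(1 - fps_X) * geometric_fps n = 1 + fps_const (n - 1) * fps_X * geometric_fps n"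
proof (rule fps_ext)
  fix m show "((1 - fps_X) * geometric_fps n) $ m =
    (1 + fps_const (n - 1) * fps_X * geometric_fps n) $ m"
    by (cases m) (simp_all add: geometric_fps_def mult.assoc algebra_simps)
qed

text \<open>The negative binomial series. Each further factor P replaces the binomial coefficients
  by their partial sums, which the hockey-stick identity \<open>sum_choose_lower\<close>
  evaluates.\<close>

lemma geometric_fps_power_nth:
  "(geometric_fps n ^ Suc d) $ m = int ((d + m) choose m) * n ^ m"
proof (induction d arbitrary: m)
  case (Suc d)
  have "(geometric_fps n ^ Suc (Suc d)) $ m =
      (\<Sum>i=0..m. (geometric_fps n ^ Suc d) $ i * n ^ (m - i))"
    by (subst power_Suc2) (simp only: fps_mult_nth geometric_fps_def fps_nth_Abs_fps)
  also have "\<dots> = (\<Sum>i=0..m. int ((d + i) choose i) * n ^ m)"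
    unfolding Suc.IH by (rule sum.cong) (simp_all add: mult.assoc flip: power_add)
  also have "\<dots> = int (\<Sum>i\<le>m. (d + i) choose i) * n ^ m"
    by (simp add: sum_distrib_right atLeast0AtMost)
  finally show ?case by (simp add: sum_choose_lower)
qed (simp add: geometric_fps_def)

lemma one_minus_X_power_nth:
  "((1 - fps_X :: int fps) ^ d) $ k = (-1) ^ k * int (d choose k)"
proof -
  have "(1 - fps_X :: int fps) ^ d = (\<Sum>k\<le>d. fps_const ((-1) ^ k * int (d choose k)) * fps_X ^ k)"
    using binomial_ring[of "- fps_X :: int fps" 1 d]
    by (simp add: power_minus[of fps_X] fps_of_nat algebra_simps flip: fps_const_mult fps_const_power fps_const_neg)
  then show ?thesis
    by (simp add: fps_sum_nth fps_X_power_mult_right_nth if_distrib sum.delta cong: if_cong)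
qed

text \<open>Cuts a convolution sum over 0..b down to the range of the target formula; in the
  application the terms with k > a vanish through a binomial coefficient.\<close>

lemma sum_upto_min_cong:
  fixes f g :: "nat \<Rightarrow> 'a :: comm_monoid_add"
  assumes "\<And>k. k \<le> b \<Longrightarrow> f k = g k" "\<And>k. k \<le> b \<Longrightarrow> k > a \<Longrightarrow> g k = 0"
  shows "(\<Sum>k=0..min a b. f k) = (\<Sum>k=0..b. g k)"
  by (rule sum.mono_neutral_cong_left) (use assms in auto)

lemma alternating_expansion:
  "((1 - fps_X) ^ d * geometric_fps n ^ Suc d) $ \<mu> =
     (\<Sum>k=0..min d \<mu>. int (d choose k) * (-1) ^ k * int ((d + \<mu> - k) choose (\<mu> - k)) * n ^ (\<mu> - k))"
  unfolding fps_mult_nth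
  by (rule sum_upto_min_cong[symmetric])
    (simp_all add: one_minus_X_power_nth geometric_fps_power_nth del: power_Suc)

text \<open>Pair d of the d + 1 factors P with the factors 1 - X, replace each pair by 1 + (n - 1) X
  P and apply the binomial theorem. The unpaired P turns the k-th term into a multiple of X^k
  P^(k+1).\<close>

lemma nonnegative_expansion:
  "((1 - fps_X) ^ d * geometric_fps n ^ Suc d) $ \<mu> =
     (\<Sum>k=0..min d \<mu>. int (d choose k) * int (\<mu> choose k) * n ^ (\<mu> - k) * (n - 1) ^ k)"
proof -
  let ?P = "geometric_fps n"
  have "(1 - fps_X) ^ d * ?P ^ Suc d = ((1 - fps_X) * ?P) ^ d * ?P"
    by (simp only: power_mult_distrib power_Suc mult_ac)
  also have "\<dots> = (fps_const (n - 1) * fps_X * ?P + 1) ^ d * ?P"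
    by (simp add: one_minus_X_times_geometric_fps add.commute)
  also have "\<dots> = (\<Sum>k\<le>d. fps_const (int (d choose k) * (n - 1) ^ k) * (fps_X ^ k * ?P ^ Suc k))"
    unfolding binomial_ring sum_distrib_right
    by (rule sum.cong) (simp_all only: power_mult_distrib fps_of_nat power_one mult_1_left mult_1_right
        power_Suc mult_ac fps_const_power flip: fps_const_mult)
  \<comment> \<open>The factor X^k shifts the degree to \<mu> - k, where P^(k+1) has coefficient
    \<open>\<mu> choose (\<mu> - k)\<close> times n^(\<mu> - k); symmetry gives
    \<open>\<mu> choose k\<close>.\<close>
  also have "\<dots> $ \<mu> =
      (\<Sum>k\<le>d. int (d choose k) * (n - 1) ^ k *
         (if \<mu> < k then 0 else int (\<mu> choose k) * n ^ (\<mu> - k)))"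
    unfolding fps_sum_nth fps_mult_left_const_nth fps_X_power_mult_nth geometric_fps_power_nth
    by (rule sum.cong) (simp_all add: binomial_symmetric[of _ \<mu>, symmetric])
  also have "\<dots> = (\<Sum>k=0..min d \<mu>. int (d choose k) * int (\<mu> choose k) * n ^ (\<mu> - k) * (n - 1) ^ k)"
    by (rule sum.mono_neutral_cong_right) auto
  finally show ?thesis .
qed

section \<open>Counting series for sets of geometrically growing size\<close>

locale geometric_nested_sets = nested_finite_sets +
  fixes c n :: nat
  assumes card_S: "card (S (Suc k)) = c * n ^ k"
begin

lemma level_fps:
  "Abs_fps (\<lambda>k. int (card {y \<in> nodes. level y = k})) =
     fps_const (int c) * ((1 - fps_X) * geometric_fps (int n))"
proof (rule fps_ext)
  fix m
  show "Abs_fps (\<lambda>k. int (card {y \<in> nodes. level y = k})) $ m =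
     (fps_const (int c) * ((1 - fps_X) * geometric_fps (int n))) $ m"
    using card_S[of 0]
    by (cases m) (simp_all add: card_level_0 card_level_Suc card_S geometric_fps_def left_diff_distrib algebra_simps)
qed

lemma bounded_level_fps:
  "Abs_fps (\<lambda>\<mu>. int (card (bounded_level_tuples (Suc d) \<mu>))) =
     fps_const (int c ^ Suc d) * ((1 - fps_X) ^ d * geometric_fps (int n) ^ Suc d)"
proof -
  let ?N = "\<lambda>d. Abs_fps (\<lambda>\<mu>. int (card (bounded_level_tuples d \<mu>)))"
  let ?F = "Abs_fps (\<lambda>k. int (card {y \<in> nodes. level y = k}))"
  have step: "?N (Suc d) = ?F * ?N d" for d
    by (rule fps_ext) (simp add: card_bounded_level_tuples_Suc fps_mult_nth atLeast0AtMost)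
  \<comment> \<open>In dimension 0 there is only the empty tuple, so all coefficients are 1 and the
    series is 1 / (1 - X), stated without division.\<close>
  have init: "(1 - fps_X) * ?N 0 = 1"
  proof (rule fps_ext)
    fix m show "((1 - fps_X) * ?N 0) $ m = 1 $ m"
      by (cases m) (simp_all add: bounded_level_tuples_0 left_diff_distrib)
  qed
  show ?thesis
  proof (induction d)
    case 0
    \<comment> \<open>One factor 1 - X is absorbed by \<open>?N 0\<close>; this is why d + 1
      coordinates leave only (1 - X)^d.\<close>
    have "?N (Suc 0) = fps_const (int c) * geometric_fps (int n) * ((1 - fps_X) * ?N 0)"
      unfolding step level_fps by (simp only: mult_ac)
    then show ?case unfolding init by simp
  next
    case (Suc d)
    show ?case unfolding step[of "Suc d"] Suc.IH level_fps
      by (simp add: mult_ac flip: fps_const_mult)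
  qed
qed

lemma smolyak_count_fps:
  assumes "d \<ge> 1"
  shows "int (smolyak_count S d \<mu>) =
    int c ^ d * ((1 - fps_X) ^ (d - 1) * geometric_fps (int n) ^ Suc (d - 1)) $ \<mu>"
proof -
  have "int (smolyak_count S d \<mu>) = Abs_fps (\<lambda>\<mu>. int (card (bounded_level_tuples (Suc (d - 1)) \<mu>))) $ \<mu>"
    using assms by (simp add: smolyak_count_def smolyak_grid_eq)
  then show ?thesis
    unfolding bounded_level_fps using assms by (simp del: power_Suc)
qed

lemma smolyak_count_alternating:
  assumes "d \<ge> 1"
  shows "int (smolyak_count S d \<mu>) =
    int c ^ d * (\<Sum>k=0..min (d - 1) \<mu>. int ((d - 1) choose k) * (-1) ^ k *
      int ((d + \<mu> - k - 1) choose (\<mu> - k)) * int n ^ (\<mu> - k))"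
proof -
  have "d - 1 + \<mu> - k = d + \<mu> - k - 1" for k using assms by simp
  then show ?thesis by (simp only: smolyak_count_fps[OF assms] alternating_expansion)
qed

lemma smolyak_count_nonnegative:
  assumes "d \<ge> 1" "n \<ge> 1"
  shows "smolyak_count S d \<mu> =
    c ^ d * (\<Sum>k=0..min (d - 1) \<mu>. ((d - 1) choose k) * (\<mu> choose k) * n ^ (\<mu> - k) * (n - 1) ^ k)"
proof -
  \<comment> \<open>The identity is proved over the integers and pulled back; n \<ge> 1 makes the
    natural number n - 1 agree with the integer one.\<close>
  have "int (smolyak_count S d \<mu>) = int
    (c ^ d * (\<Sum>k=0..min (d - 1) \<mu>. ((d - 1) choose k) * (\<mu> choose k) * n ^ (\<mu> - k) * (n - 1) ^ k))"
    unfolding smolyak_count_fps[OF assms(1)] nonnegative_expansion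
    using assms(2) by (simp add: of_nat_diff)
  then show ?thesis by (simp only: of_nat_eq_iff)
qed

end

text \<open>Since k \<le> \<mu> throughout the range, d + (\<mu> - k) equals \<mu> + d - k despite
  truncated subtraction.\<close>

lemma power_times_sum_shift:
  "(n::nat) ^ d * (\<Sum>k=0..min (d - 1) \<mu>. ((d - 1) choose k) * (\<mu> choose k) * n ^ (\<mu> - k) * m ^ k) =
     (\<Sum>k=0..min (d - 1) \<mu>. ((d - 1) choose k) * (\<mu> choose k) * n ^ (\<mu> + d - k) * m ^ k)"
  unfolding sum_distrib_left
proof (rule sum.cong[OF refl])
  fix k assume "k \<in> {0..min (d - 1) \<mu>}"
  then have "n ^ (\<mu> + d - k) = n ^ d * n ^ (\<mu> - k)" by (simp add: add.commute flip: power_add)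
  then show "n ^ d * (((d - 1) choose k) * (\<mu> choose k) * n ^ (\<mu> - k) * m ^ k) =
      ((d - 1) choose k) * (\<mu> choose k) * n ^ (\<mu> + d - k) * m ^ k" by simp
qed

section \<open>Chebyshev nodes of the first kind\<close>

lemma cheb1_eq_image:
  "cheb1 m = (\<lambda>k. cos ((2 * real k - 1) / (2 * real m) * pi)) ` {1..m}"
  by (auto simp: cheb1_def)

lemma finite_cheb1: "finite (cheb1 m)"
  by (simp add: cheb1_eq_image)

text \<open>All the angles lie in [0, pi], where the cosine is injective.\<close>

lemma card_cheb1: "card (cheb1 m) = m"
proof -
  have "inj_on (\<lambda>k. cos ((2 * real k - 1) / (2 * real m) * pi)) {1..m}"
  proof (rule inj_onI)
    fix j k assume jk: "j \<in> {1..m}" "k \<in> {1..m}"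
      and eq: "cos ((2 * real j - 1) / (2 * real m) * pi) = cos ((2 * real k - 1) / (2 * real m) * pi)"
    have *: "0 \<le> (2 * real i - 1) / (2 * real m) * pi \<and> (2 * real i - 1) / (2 * real m) * pi \<le> pi"
      if "i \<in> {1..m}" for i
    proof -
      have "0 \<le> (2 * real i - 1) / (2 * real m)" "(2 * real i - 1) / (2 * real m) \<le> 1"
        using that by (auto simp: divide_le_eq)
      then show ?thesis by (intro conjI mult_nonneg_nonneg mult_left_le_one_le pi_ge_zero)
    qed
    have "(2 * real j - 1) / (2 * real m) * pi = (2 * real k - 1) / (2 * real m) * pi"
      by (rule cos_inj_pi) (use * jk eq in auto)
    then show "j = k" using jk by simp
  qed
  then show ?thesis by (simp add: cheb1_eq_image card_image)
qed

text \<open>The k-th angle for m is the angle number 3k - 1 for 3m, because 2 (3k - 1) - 1 = 3 (2k -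
  1).\<close>

lemma cheb1_subset_triple: "cheb1 m \<subseteq> cheb1 (3 * m)"
proof
  fix y assume "y \<in> cheb1 m"
  then obtain k where k: "k \<in> {1..m}" "y = cos ((2 * real k - 1) / (2 * real m) * pi)"
    by (auto simp: cheb1_def)
  have "(2 * real k - 1) / (2 * real m) = (2 * real (3 * k - 1) - 1) / (2 * real (3 * m))"
    using k(1) by (simp add: of_nat_diff field_simps)
  then show "y \<in> cheb1 (3 * m)"
    using k by (auto simp: cheb1_def intro!: exI[of _ "3 * k - 1"])
qed

text \<open>The set at index k + 1 has 3^(k+1) = 3 * 3^k elements, hence c = 3; for the shifted
  sequence it has 3^k, hence c = 1.\<close>

interpretation cheb: geometric_nested_sets "\<lambda>k. cheb1 (3 ^ k)" 3 3
  by unfold_locales (auto simp: nested_def finite_cheb1 card_cheb1 cheb1_subset_triple[THEN subsetD])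

interpretation cheb_shifted: geometric_nested_sets "\<lambda>k. cheb1 (3 ^ (k - 1))" 1 3
proof unfold_locales
  have "cheb1 (3 ^ (k - 1)) \<subseteq> cheb1 (3 ^ k)" if "k \<ge> 1" for k
    using that cheb1_subset_triple[of "3 ^ (k - 1)"] by (cases k) auto
  then show "nested (\<lambda>k. cheb1 (3 ^ (k - 1)))" by (simp add: nested_def)
qed (auto simp: finite_cheb1 card_cheb1)

theorem mainTheorem2:
  shows
    "(\<forall>(n::nat) (S :: nat \<Rightarrow> real set).
        n \<ge> 1 \<longrightarrow> (\<forall>k\<ge>1. finite (S k) \<and> S k \<subseteq> {-1..1}) \<longrightarrow> nested S \<longrightarrow>
        (\<forall>k\<ge>1. card (S k) = n ^ k) \<longrightarrow>
        (\<forall>(d::nat) (\<mu>::nat). d \<ge> 1 \<longrightarrow>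
           int (smolyak_count S d \<mu>) =
             int n ^ d * (\<Sum>k=0..min (d - 1) \<mu>. int ((d - 1) choose k) * (-1) ^ k *
               int ((d + \<mu> - k - 1) choose (\<mu> - k)) * int n ^ (\<mu> - k)) \<and>
           smolyak_count S d \<mu> =
             (\<Sum>k=0..min (d - 1) \<mu>. ((d - 1) choose k) * (\<mu> choose k) *
               n ^ (\<mu> + d - k) * (n - 1) ^ k))) \<and>
     (\<forall>(d::nat) (\<mu>::nat). d \<ge> 1 \<longrightarrow>
        smolyak_count (\<lambda>k. cheb1 (3 ^ k)) d \<mu> =
          (\<Sum>k=0..min (d - 1) \<mu>. ((d - 1) choose k) * (\<mu> choose k) *
            3 ^ (\<mu> + d - k) * 2 ^ k)) \<and>
     (\<forall>(d::nat) (\<mu>::nat). d \<ge> 1 \<longrightarrow>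
        real (smolyak_count (\<lambda>k. cheb1 (3 ^ (k - 1))) d \<mu>) =
          real (\<Sum>k=0..min (d - 1) \<mu>. ((d - 1) choose k) * (\<mu> choose k) *
            3 ^ (\<mu> + d - k) * 2 ^ k) / 3 ^ d \<and>
        smolyak_count (\<lambda>k. cheb1 (3 ^ (k - 1))) d \<mu> =
          (\<Sum>k=0..min (d - 1) \<mu>. ((d - 1) choose k) * (\<mu> choose k) *
            3 ^ (\<mu> - k) * 2 ^ k))"
proof (intro conjI allI impI)
  fix n d \<mu> :: nat and S :: "nat \<Rightarrow> real set"
  assume *: "n \<ge> 1" "\<forall>k\<ge>1. finite (S k) \<and> S k \<subseteq> {-1..1}" "nested S" "\<forall>k\<ge>1. card (S k) = n ^ k"
    and d: "d \<ge> 1"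
  \<comment> \<open>Here c = n, because n^(k+1) = n * n^k.\<close>
  interpret geometric_nested_sets S n n
    by unfold_locales (use * in auto)
  show "int (smolyak_count S d \<mu>) =
      int n ^ d * (\<Sum>k=0..min (d - 1) \<mu>. int ((d - 1) choose k) * (-1) ^ k *
        int ((d + \<mu> - k - 1) choose (\<mu> - k)) * int n ^ (\<mu> - k))"
    using d by (rule smolyak_count_alternating)
  show "smolyak_count S d \<mu> =
      (\<Sum>k=0..min (d - 1) \<mu>. ((d - 1) choose k) * (\<mu> choose k) * n ^ (\<mu> + d - k) * (n - 1) ^ k)"
    using smolyak_count_nonnegative[OF d \<open>n \<ge> 1\<close>] by (simp only: power_times_sum_shift)
next
  fix d \<mu> :: nat assume d: "d \<ge> 1"
  show "smolyak_count (\<lambda>k. cheb1 (3 ^ k)) d \<mu> =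
      (\<Sum>k=0..min (d - 1) \<mu>. ((d - 1) choose k) * (\<mu> choose k) * 3 ^ (\<mu> + d - k) * 2 ^ k)"
    using cheb.smolyak_count_nonnegative[OF d, of \<mu>] power_times_sum_shift[of 3 d \<mu> 2] by simp
  show shifted: "smolyak_count (\<lambda>k. cheb1 (3 ^ (k - 1))) d \<mu> =
      (\<Sum>k=0..min (d - 1) \<mu>. ((d - 1) choose k) * (\<mu> choose k) * 3 ^ (\<mu> - k) * 2 ^ k)"
    using cheb_shifted.smolyak_count_nonnegative[OF d, of \<mu>] by simp
  show "real (smolyak_count (\<lambda>k. cheb1 (3 ^ (k - 1))) d \<mu>) =
      real (\<Sum>k=0..min (d - 1) \<mu>. ((d - 1) choose k) * (\<mu> choose k) *
        3 ^ (\<mu> + d - k) * 2 ^ k) / 3 ^ d"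
    \<comment> \<open>Read backwards, the shift lemma pulls 3^d out of the sum, and it cancels with
      the denominator.\<close>
    unfolding shifted power_times_sum_shift[symmetric] by simp
qed

end
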